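(* Let $\mathcal{H}_S=\mathcal{H}_L\otimes\mathcal{H}_A$ be finite-dimensional with $d_L=\dim\mathcal{H}_L$, $d_S=\dim\mathcal{H}_S\geq 2$, and let $|0\rangle_A\in\mathcal{H}_A$ be a fixed unit vector. For a unitary $U\in\mathbf{U}(d_S)$ on $\mathcal{H}_S$ let $\mathcal{E}=\mathcal{E}_U$ be the isometric encoding channel $\mathcal{E}(\rho)=W\rho W^{\dagger}$ with $W=U(\mathbf{1}_L\otimes|0\rangle_A)$. Let $\mathcal{N}(\sigma)=\sum_{i=1}^{n}A_i\sigma A_i^{\dagger}$ be a noise channel on $S$ with $\sum_{i=1}^nA_i^{\dagger}A_i=\mathbf{1}_S$. Then, with $\mu$ the normalized Haar measure on the unitary group $\mathbf{U}(d_S)$, $$\int_{\mathbf{U}(d_S)}\epsilon^2(\mathcal{N}\circ\mathcal{E})\,d\mu(U)=\frac{n(d_L^2-1)}{4d_L(d_S^2-1)}\sum_{i,j=1}^{n}\left(\mathrm{tr}(A_j^{\dagger}A_iA_i^{\dagger}A_j)-\frac{1}{d_S}\left|\mathrm{tr}(A_i^{\dagger}A_j)\right|^2\right).$$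
   Context: For an isometric encoding $\mathcal{E}(\rho)=W\rho W^{\dagger}$ ($W^{\dagger}W=\mathbf{1}_L$) with projector $P=WW^{\dagger}$ onto the code space, and noise with Kraus operators $A_1,\dots,A_n$, the infidelity $\epsilon(\mathcal{N}\circ\mathcal{E})\ge 0$ is defined by $$\epsilon^2(\mathcal{N}\circ\mathcal{E})=\frac{n}{4d_L}\sum_{i,j=1}^{n}\left(\mathrm{tr}(PA_j^{\dagger}A_iPA_i^{\dagger}A_j)-\frac{1}{d_L}|\mathrm{tr}(PA_i^{\dagger}A_j)|^2\right).$$ For the random code here, $P=U(\mathbf{1}_L\otimes|0\rangle\langle0|_A)U^{\dagger}$. *)

theory Defs
  imports "HOL-Probability.Probability"
begin

definition adj :: "complex^'m^'n \<Rightarrow> complex^'n^'m" where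
  "adj A = map_matrix cnj (transpose A)"

definition unitary_group :: "(complex^'n^'n) set" where
  "unitary_group = {U. adj U ** U = mat 1 \<and> U ** adj U = mat 1}"

(* Left invariance together with normalisation determines the measure, and right invariance
   follows, because the unitary group is compact. *)
definition normalized_haar :: "(complex^'n^'n) measure \<Rightarrow> bool" where
  "normalized_haar \<mu> \<longleftrightarrow>
     prob_space \<mu> \<and>
     sets \<mu> = sets (restrict_space borel unitary_group) \<and>
     (\<forall>V \<in> unitary_group. distr \<mu> \<mu> (\<lambda>U. V ** U) = \<mu>)"

(* The matrix of the map \<psi> \<mapsto> \<psi> \<otimes> v from C^'l to C^'l \<otimes> C^'a = C^('l \<times> 'a),
   that is, of 1_L \<otimes> |v>. *)
definition append_state :: "complex^'a \<Rightarrow> complex^'l^('l \<times> 'a)" where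
  "append_state v = (\<chi> p l. mat 1 $ fst p $ l * v $ snd p)"

definition encoder :: "complex^('l::finite \<times> 'a::finite)^('l \<times> 'a) \<Rightarrow> complex^'a \<Rightarrow> complex^'l^('l \<times> 'a)" where
  "encoder U v = U ** append_state v"

definition code_projector :: "complex^'l^'s \<Rightarrow> complex^'s^'s" where
  "code_projector W = W ** adj W"

(* The infidelity of the noise with Kraus operators A 1, ..., A n following the encoding
   \<rho> \<mapsto> W \<rho> W^\<dagger>.  It is a function of the Kraus family and not of the noise channel
   alone: the prefactor n changes, for instance, when a zero operator is appended.
   For isometric W the right-hand side is real and nonnegative, so the number described
   exists. *)
definition infidelity :: "complex^'l^'s \<Rightarrow> nat \<Rightarrow> (nat \<Rightarrow> complex^'s^'s) \<Rightarrow> real" where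
  "infidelity W n A = (THE e. e \<ge> 0 \<and>
     complex_of_real (e\<^sup>2) =
       of_nat n / (4 * of_nat CARD('l)) *
       (\<Sum>i = 1..n. \<Sum>j = 1..n.
          trace (code_projector W ** adj (A j) ** A i ** code_projector W ** adj (A i) ** A j)
          - 1 / of_nat CARD('l)
            * of_real ((cmod (trace (code_projector W ** adj (A i) ** A j)))\<^sup>2)))"

end

theory Submission
  imports Defs
begin

text \<open>
  With \<open>X = A\<^sub>j\<^sup>* A\<^sub>i\<close> and \<open>Y = X\<^sup>*\<close>, where \<open>*\<close> is the adjoint, the squared infidelity is a sum of terms
  \<open>tr (P X P Y) - tr (P X) tr (P Y) / d\<^sub>L\<close>, which are linear in the entries \<open>P\<^sub>a\<^sub>b P\<^sub>c\<^sub>d\<close> of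
  \<open>P \<otimes> P\<close>. Left invariance of the Haar measure makes the expectation of \<open>P \<otimes> P\<close> commute with
  all \<open>V \<otimes> V\<close>, so it is a combination \<open>\<alpha> 1 + \<beta> SWAP\<close>. The coefficients follow from
  \<open>tr P = d\<^sub>L\<close> and \<open>P\<^sup>2 = P\<close>, that is, from \<open>\<alpha> d\<^sub>S\<^sup>2 + \<beta> d\<^sub>S = d\<^sub>L\<^sup>2\<close> and \<open>\<alpha> d\<^sub>S + \<beta> d\<^sub>S\<^sup>2 = d\<^sub>L\<close>.
  To identify the commutant it is enough to test with diagonal gates with one entry \<open>\<i>\<close>, with
  transpositions, and with one reflection in each coordinate plane.
\<close>

section \<open>Adjoints and traces\<close>

lemma adj_nth [simp]: "adj A $ i $ j = cnj (A $ j $ i)"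
  by (simp add: adj_def transpose_def)

lemma adj_adj [simp]: "adj (adj A) = A"
  by (simp add: vec_eq_iff)

lemma adj_mult: "adj (A ** B) = adj B ** adj A"
  by (simp add: vec_eq_iff matrix_matrix_mult_def mult.commute)

lemma trace_adj: "trace (adj A) = cnj (trace A)"
  by (simp add: trace_def)

lemma trace_mult_adj: "trace (C ** adj C) = of_real (\<Sum>a\<in>UNIV. \<Sum>b\<in>UNIV. (cmod (C $ a $ b))\<^sup>2)"
  by (simp add: trace_def matrix_matrix_mult_def complex_norm_square del: of_real_power)

text \<open>Cauchy-Schwarz on the diagonal, after which the off-diagonal squares are added. It makes
  every summand of the squared infidelity nonnegative.\<close>

lemma cmod_trace_squared_le:
  fixes C :: "complex^'l^'l"
  shows "(cmod (trace C))\<^sup>2 \<le> real CARD('l) * (\<Sum>a\<in>UNIV. \<Sum>b\<in>UNIV. (cmod (C $ a $ b))\<^sup>2)"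
proof -
  have "(cmod (trace C))\<^sup>2 \<le> (\<Sum>a\<in>UNIV. cmod (C $ a $ a))\<^sup>2"
    unfolding trace_def by (intro power_mono norm_sum) auto
  also have "\<dots> \<le> (\<Sum>a\<in>UNIV. (cmod (C $ a $ a))\<^sup>2) * real CARD('l)"
    by (rule sum_squared_le_sum_of_squares)
  also have "\<dots> \<le> (\<Sum>a\<in>UNIV. \<Sum>b\<in>UNIV. (cmod (C $ a $ b))\<^sup>2) * real CARD('l)"
    by (intro mult_right_mono sum_mono member_le_sum[of _ UNIV "\<lambda>b. (cmod (C $ _ $ b))\<^sup>2"]) auto
  finally show ?thesis by (simp add: mult.commute)
qed

text \<open>Exhibits the trace as a linear functional of the products
  \<open>P $ a $ b * P $ c $ d\<close>, so that only these have to be integrated. The summation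
  order is the one used in \<open>sum_invariant_tensor\<close>.\<close>

lemma trace_mult_mult_nth:
  fixes P X Y :: "complex^'s^'s"
  shows "trace (P ** X ** P ** Y) =
    (\<Sum>a\<in>UNIV. \<Sum>b\<in>UNIV. \<Sum>c\<in>UNIV. \<Sum>d\<in>UNIV. X $ b $ c * Y $ d $ a * (P $ a $ b * P $ c $ d))"
proof -
  have "trace (P ** X ** P ** Y) =
    (\<Sum>a\<in>UNIV. \<Sum>d\<in>UNIV. \<Sum>c\<in>UNIV. \<Sum>b\<in>UNIV. X $ b $ c * Y $ d $ a * (P $ a $ b * P $ c $ d))"
    unfolding trace_def matrix_matrix_mult_def
    by (simp add: sum_distrib_left sum_distrib_right) (intro sum.cong refl, simp add: mult_ac)
  also have "\<dots> = (\<Sum>a\<in>UNIV. \<Sum>b\<in>UNIV. \<Sum>c\<in>UNIV. \<Sum>d\<in>UNIV. X $ b $ c * Y $ d $ a * (P $ a $ b * P $ c $ d))"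
  proof (rule sum.cong[OF refl])
    fix a
    let ?f = "\<lambda>b c d. X $ b $ c * Y $ d $ a * (P $ a $ b * P $ c $ d)"
    have "(\<Sum>d\<in>UNIV. \<Sum>c\<in>UNIV. \<Sum>b\<in>UNIV. ?f b c d) = (\<Sum>d\<in>UNIV. \<Sum>b\<in>UNIV. \<Sum>c\<in>UNIV. ?f b c d)"
      by (rule sum.cong[OF refl], rule sum.swap)
    also have "\<dots> = (\<Sum>b\<in>UNIV. \<Sum>d\<in>UNIV. \<Sum>c\<in>UNIV. ?f b c d)"
      by (rule sum.swap)
    also have "\<dots> = (\<Sum>b\<in>UNIV. \<Sum>c\<in>UNIV. \<Sum>d\<in>UNIV. ?f b c d)"
      by (rule sum.cong[OF refl], rule sum.swap)
    finally show "(\<Sum>d\<in>UNIV. \<Sum>c\<in>UNIV. \<Sum>b\<in>UNIV. ?f b c d) = (\<Sum>b\<in>UNIV. \<Sum>c\<in>UNIV. \<Sum>d\<in>UNIV. ?f b c d)" .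
  qed
  finally show ?thesis .
qed

lemma trace_times_trace_nth:
  fixes P X Y :: "complex^'s^'s"
  shows "trace (P ** X) * trace (P ** Y) =
    (\<Sum>a\<in>UNIV. \<Sum>b\<in>UNIV. \<Sum>c\<in>UNIV. \<Sum>d\<in>UNIV. X $ b $ a * Y $ d $ c * (P $ a $ b * P $ c $ d))"
proof -
  have tr: "trace (P ** Z) = (\<Sum>a\<in>UNIV. \<Sum>b\<in>UNIV. P $ a $ b * Z $ b $ a)" for Z
    by (simp add: trace_def matrix_matrix_mult_def)
  have "trace (P ** X) * trace (P ** Y) = (\<Sum>a\<in>UNIV. \<Sum>b\<in>UNIV. P $ a $ b * X $ b $ a * trace (P ** Y))"
    unfolding tr[of X] by (simp only: sum_distrib_right)
  also have "\<dots> = (\<Sum>a\<in>UNIV. \<Sum>b\<in>UNIV. \<Sum>c\<in>UNIV. \<Sum>d\<in>UNIV. X $ b $ a * Y $ d $ c * (P $ a $ b * P $ c $ d))"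
    unfolding tr[of Y] sum_distrib_left by (intro sum.cong refl) (simp add: mult_ac)
  finally show ?thesis .
qed

section \<open>The infidelity\<close>

text \<open>Removes the definite description. Put \<open>C = adj W ** adj (A j) ** A i ** W\<close>:
  the first trace is the squared Frobenius norm of \<open>C\<close> and the second is the conjugate
  of \<open>trace C\<close>, so the defining expression is real and nonnegative. The squared modulus
  becomes a product of two traces, which makes each summand linear in the entries of P \<otimes>
  P.\<close>

lemma infidelity_squared:
  fixes W :: "complex^'l^'s" and A :: "nat \<Rightarrow> complex^'s^'s"
  shows "complex_of_real ((infidelity W n A)\<^sup>2) =
    of_nat n / (4 * of_nat CARD('l)) *
       (\<Sum>i = 1..n. \<Sum>j = 1..n.
          trace (code_projector W ** (adj (A j) ** A i) ** code_projector W ** (adj (A i) ** A j))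
          - 1 / of_nat CARD('l)
            * (trace (code_projector W ** (adj (A j) ** A i)) * trace (code_projector W ** (adj (A i) ** A j))))"
    (is "_ = ?R")
proof -
  let ?P = "code_projector W"
  let ?C = "\<lambda>i j. adj W ** adj (A j) ** A i ** W"
  let ?F = "\<lambda>i j. (\<Sum>a\<in>UNIV. \<Sum>b\<in>UNIV. (cmod (?C i j $ a $ b))\<^sup>2)"
  define r where "r = real n / (4 * real CARD('l)) * (\<Sum>i = 1..n. \<Sum>j = 1..n.
      ?F i j - 1 / real CARD('l) * (cmod (trace (?C i j)))\<^sup>2)"
  have 1: "trace (?P ** adj (A j) ** A i ** ?P ** adj (A i) ** A j) = of_real (?F i j)" for i j
  proof -
    have "trace (?P ** adj (A j) ** A i ** ?P ** adj (A i) ** A j)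
      = trace (W ** (adj W ** adj (A j) ** A i ** W ** adj W ** adj (A i) ** A j))"
      by (simp add: code_projector_def matrix_mul_assoc)
    \<comment> \<open>Cyclicity moves the leading \<open>W\<close> to the end, and the word then
      splits in the middle into a matrix and its adjoint.\<close>
    also have "\<dots> = trace (?C i j ** adj (?C i j))"
      by (subst trace_mul_sym) (simp add: adj_mult matrix_mul_assoc)
    finally show ?thesis by (simp add: trace_mult_adj)
  qed
  have 2: "trace (?P ** adj (A i) ** A j) = cnj (trace (?C i j))" for i j
  proof -
    have "trace (?P ** adj (A i) ** A j) = trace (W ** (adj W ** adj (A i) ** A j))"
      by (simp add: code_projector_def matrix_mul_assoc)
    also have "\<dots> = trace (adj (?C i j))"
      by (subst trace_mul_sym) (simp add: adj_mult matrix_mul_assoc)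
    finally show ?thesis by (simp add: trace_adj)
  qed
  have r: "of_real r = of_nat n / (4 * of_nat CARD('l)) *
       (\<Sum>i = 1..n. \<Sum>j = 1..n.
          trace (?P ** adj (A j) ** A i ** ?P ** adj (A i) ** A j)
          - 1 / of_nat CARD('l) * of_real ((cmod (trace (?P ** adj (A i) ** A j)))\<^sup>2))"
    unfolding 1 2 by (simp add: r_def)
  have "0 \<le> r"
    unfolding r_def
  proof (intro mult_nonneg_nonneg sum_nonneg)
    fix i j
    show "0 \<le> ?F i j - 1 / real CARD('l) * (cmod (trace (?C i j)))\<^sup>2"
      using cmod_trace_squared_le[of "?C i j"] by (simp add: field_simps)
  qed simp
  then have "infidelity W n A = sqrt r"
    unfolding infidelity_def r[symmetric] of_real_eq_iff
    by (intro the_equality) (auto simp: real_sqrt_unique)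
  then have "complex_of_real ((infidelity W n A)\<^sup>2) = of_real r"
    using \<open>0 \<le> r\<close> by simp
  also have "\<dots> = ?R"
  proof -
    have "complex_of_real ((cmod (trace (?P ** adj (A i) ** A j)))\<^sup>2) =
      trace (?P ** (adj (A j) ** A i)) * trace (?P ** (adj (A i) ** A j))" for i j
      using 2[of i j] 2[of j i] trace_adj[of "?C i j"]
      by (simp add: complex_norm_square matrix_mul_assoc adj_mult mult.commute del: of_real_power)
    then show ?thesis unfolding r by (simp add: matrix_mul_assoc)
  qed
  finally show ?thesis .
qed

section \<open>Tensors invariant under the unitary group\<close>

definition phase_gate :: "'s \<Rightarrow> complex^'s^'s" where
  "phase_gate x = (\<chi> a b. if a = b then if a = x then \<i> else 1 else 0)"

text \<open>A reflection in the plane of \<open>x\<close> and \<open>y\<close>, chosen instead of a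
  rotation because it is real symmetric and thus its own adjoint. The parameters 0 and 1 give the
  transposition of \<open>x\<close> and \<open>y\<close>.\<close>

definition two_level :: "'s \<Rightarrow> 's \<Rightarrow> real \<Rightarrow> real \<Rightarrow> complex^'s^'s" where
  "two_level x y c s = (\<chi> a b.
     if a = x then (if b = x then c else if b = y then s else 0)
     else if a = y then (if b = x then s else if b = y then - c else 0)
     else if a = b then 1 else 0)"

text \<open>The conjugated version is stated as well because in \<open>V ** P ** adj V\<close> the
  column index of P is contracted with the conjugate of V. As rewrite rules the two equations
  collapse the nested sums of the invariance condition.\<close>

lemma sum_phase_gate:
  "(\<Sum>b\<in>UNIV. phase_gate x $ a $ b * f b) = (if a = x then \<i> * f a else f a)"
  "(\<Sum>b\<in>UNIV. cnj (phase_gate x $ a $ b) * f b) = (if a = x then - \<i> * f a else f a)"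
  by (simp_all add: phase_gate_def if_distrib[of cnj] if_distribR if_distrib[of "\<lambda>z. z * _"] cong: if_cong)

lemma sum_two_level:
  assumes "x \<noteq> y"
  shows "(\<Sum>b\<in>UNIV. two_level x y c s $ a $ b * f b) =
    (if a = x then c * f x + s * f y else if a = y then s * f x - c * f y else f a)" (is ?A)
  and "(\<Sum>b\<in>UNIV. cnj (two_level x y c s $ a $ b) * f b) =
    (if a = x then c * f x + s * f y else if a = y then s * f x - c * f y else f a)" (is ?B)
proof -
  have two: "(\<Sum>b\<in>UNIV. (if b = x then p else if b = y then q else 0) * f b) = p * f x + q * f y" for p q
  proof -
    have "(\<Sum>b\<in>UNIV. (if b = x then p else if b = y then q else 0) * f b)
      = (\<Sum>b\<in>UNIV. (if b = x then p * f b else 0) + (if b = y then q * f b else 0))"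
      using assms by (intro sum.cong) auto
    then show ?thesis by (simp add: sum.distrib)
  qed
  have one: "(\<Sum>b\<in>UNIV. (if a = b then 1 else 0) * f b) = f a"
    by (simp add: if_distrib[of "\<lambda>z. z * _"] cong: if_cong)
  show ?A
    by (cases "a = x"; cases "a = y") (use assms in \<open>simp_all add: two_level_def two one\<close>)
  have "cnj (two_level x y c s $ a $ b) = two_level x y c s $ a $ b" for b
    by (simp add: two_level_def)
  then show ?B using \<open>?A\<close> by simp
qed

lemma phase_gate_unitary: "phase_gate x \<in> unitary_group"
proof -
  \<comment> \<open>Symmetry turns a sum down a column into a sum along a row, to which
    \<open>sum_phase_gate\<close> applies.\<close>
  have sym: "phase_gate x $ k $ b = phase_gate x $ b $ k" for k b
    by (simp add: phase_gate_def)
  have "(adj (phase_gate x) ** phase_gate x) $ a $ b = mat 1 $ a $ b" for a b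
    unfolding matrix_matrix_mult_def
    by (simp add: sym[of _ a] sum_phase_gate) (simp add: phase_gate_def mat_def)
  moreover have "(phase_gate x ** adj (phase_gate x)) $ a $ b = mat 1 $ a $ b" for a b
    unfolding matrix_matrix_mult_def
    by (simp add: sum_phase_gate) (simp add: phase_gate_def mat_def)
  ultimately show ?thesis
    by (simp add: unitary_group_def vec_eq_iff)
qed

lemma two_level_unitary:
  assumes "x \<noteq> y" "c\<^sup>2 + s\<^sup>2 = 1"
  shows "two_level x y c s \<in> unitary_group"
proof -
  have cs: "of_real c * of_real c + of_real s * of_real s = (1::complex)"
    using assms(2) by (metis of_real_1 of_real_add of_real_mult power2_eq_square)
  have sym: "two_level x y c s $ k $ b = two_level x y c s $ b $ k" for k b
    using assms(1) by (auto simp: two_level_def)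
  have "(adj (two_level x y c s) ** two_level x y c s) $ a $ b = mat 1 $ a $ b" for a b
    unfolding matrix_matrix_mult_def using assms(1) cs
    by (simp add: sym[of _ a] sum_two_level) (auto simp add: two_level_def mat_def algebra_simps)
  moreover have "(two_level x y c s ** adj (two_level x y c s)) $ a $ b = mat 1 $ a $ b" for a b
    unfolding matrix_matrix_mult_def using assms(1) cs
    by (simp add: sum_two_level) (auto simp add: two_level_def mat_def algebra_simps)
  ultimately show ?thesis
    by (simp add: unitary_group_def vec_eq_iff)
qed

text \<open>
  A phase gate at \<open>x\<close> forces \<open>M a b c d = 0\<close> unless \<open>x\<close> occurs equally often in \<open>{a, c}\<close> and in
  \<open>{b, d}\<close>. Transpositions make the remaining off-diagonal entries constant, and the 3-4-5
  reflection yields \<open>M x x x x = \<alpha> + \<beta>\<close>.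
\<close>
lemma unitary_invariant_tensor:
  fixes M :: "'s::finite \<Rightarrow> 's \<Rightarrow> 's \<Rightarrow> 's \<Rightarrow> complex"
  assumes inv: "\<And>V a b c d. V \<in> unitary_group \<Longrightarrow>
    M a b c d = (\<Sum>a'\<in>UNIV. V $ a $ a' * (\<Sum>b'\<in>UNIV. cnj (V $ b $ b') *
      (\<Sum>c'\<in>UNIV. V $ c $ c' * (\<Sum>d'\<in>UNIV. cnj (V $ d $ d') * M a' b' c' d'))))"
  obtains \<alpha> \<beta> where
    "\<And>a b c d. M a b c d = (if a = b \<and> c = d then \<alpha> else 0) + (if a = d \<and> b = c then \<beta> else 0)"
proof -
  have zero: "M a b c d = 0" if "\<not> (a = b \<and> c = d)" "\<not> (a = d \<and> b = c)" for a b c d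
  proof -
    \<comment> \<open>The scalar by which the phase gate at \<open>x\<close> multiplies the entry:
      \<i> for each of \<open>a\<close>, \<open>c\<close> equal to \<open>x\<close>, and its
      conjugate for each of \<open>b\<close>, \<open>d\<close> equal to \<open>x\<close>.\<close>
    define \<phi> :: "'s \<Rightarrow> complex" where
      "\<phi> x = (if a = x then \<i> else 1) * (if b = x then - \<i> else 1) * (if c = x then \<i> else 1) * (if d = x then - \<i> else 1)" for x
    have "M a b c d = \<phi> x * M a b c d" for x
      by (rule trans[OF inv[OF phase_gate_unitary[of x], of a b c d]])
        (simp add: sum_phase_gate \<phi>_def)
    \<comment> \<open>\<open>\<phi> x\<close> is \<i> to the power of a difference of multiplicities
      between -2 and 2, so it is 1 only when the difference is 0. If that held at \<open>a\<close>
      and at \<open>c\<close>, the multisets of \<open>a\<close>, \<open>c\<close> and of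
      \<open>b\<close>, \<open>d\<close> would agree, which is excluded.\<close>
    moreover have "\<phi> a \<noteq> 1 \<or> \<phi> c \<noteq> 1"
      using that by (cases "a = c"; cases "b = a"; cases "d = a"; simp add: \<phi>_def complex_eq_iff)
    ultimately show ?thesis
      by (metis mult_cancel_right1)
  qed
  have rot: "M a b c d = (\<Sum>a'\<in>UNIV. two_level x y p q $ a $ a' * (\<Sum>b'\<in>UNIV. cnj (two_level x y p q $ b $ b') *
      (\<Sum>c'\<in>UNIV. two_level x y p q $ c $ c' * (\<Sum>d'\<in>UNIV. cnj (two_level x y p q $ d $ d') * M a' b' c' d'))))"
    if "x \<noteq> y" "p\<^sup>2 + q\<^sup>2 = 1" for a b c d x y p q
    using that by (intro inv two_level_unitary)
  \<comment> \<open>With parameters 0 and 1 the reflection is the permutation matrix of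
    \<open>f\<close>, so invariance is relabelling of indices.\<close>
  have swap: "M a b c d = M (f a) (f b) (f c) (f d)"
    if "x \<noteq> y" "f = (\<lambda>a. if a = x then y else if a = y then x else a)" for a b c d x y f
    by (rule trans[OF rot[OF that(1), of 0 1 a b c d]]) (simp_all add: sum_two_level[OF that(1)] that(2))
  have diag: "M x x x x = M y y y y \<and> M x x x x = M x x y y + M x y y x" if "x \<noteq> y" for x y
  proof -
    \<comment> \<open>The Pythagorean triple keeps the coefficients rational: 81, 256 and 144 over
      625 are the fourth powers of 3/5 and 4/5 and the product of their squares. Each of the two
      mixed entries occurs twice by symmetry, hence 288.\<close>
    have pq: "(3/5)\<^sup>2 + (4/5)\<^sup>2 = (1::real)" by (simp add: power2_eq_square)
    have z: "M x x x y = 0" "M x x y x = 0" "M x y x x = 0" "M y x x x = 0" "M y y y x = 0" "M y y x y = 0"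
      "M y x y y = 0" "M x y y y = 0" "M x y x y = 0" "M y x y x = 0"
      using that by (auto intro!: zero)
    have s: "M y y x x = M x x y y" "M y x x y = M x y y x"
      using swap[OF that refl, of y y x x] swap[OF that refl, of y x x y] that by auto
    let ?S = "M x x y y + M x y y x"
    have "M x x x x = (81 * M x x x x + 256 * M y y y y + 288 * ?S) / 625"
      by (rule trans[OF rot[OF that pq, of x x x x]]) (simp only: sum_two_level[OF that], use that in \<open>simp add: z s field_simps\<close>)
    then have 1: "544 * M x x x x = 256 * M y y y y + 288 * ?S"
      by (simp add: field_simps)
    have "M y y y y = (256 * M x x x x + 81 * M y y y y + 288 * ?S) / 625"
      by (rule trans[OF rot[OF that pq, of y y y y]]) (simp only: sum_two_level[OF that], use that in \<open>simp add: z s field_simps\<close>)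
    then have 2: "544 * M y y y y = 256 * M x x x x + 288 * ?S"
      by (simp add: field_simps)
    \<comment> \<open>Difference of the two equations, with 544 + 256 = 800.\<close>
    have "800 * (M x x x x - M y y y y) = 0"
      using 1 2 by algebra
    then have 3: "M x x x x = M y y y y" by simp
    have "288 * M x x x x = 544 * M x x x x - 256 * M y y y y"
      by (simp add: 3)
    then have "288 * M x x x x = 288 * ?S"
      unfolding 1 by simp
    then have "M x x x x = ?S"
      by (metis mult_left_cancel zero_neq_numeral)
    with 3 show ?thesis by simp
  qed
  note diag_eq = conjunct1[OF diag] and diag_sum = conjunct2[OF diag]
  have sym: "M x x y y = M y y x x" if "x \<noteq> y" for x y
    using swap[OF that refl, of x x y y] that by simp
  have move: "M x x y y = M x x z z" if "x \<noteq> y" "x \<noteq> z" for x y z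
    using swap[OF _ refl, of y z x x y y] that by (cases "y = z") auto
  \<comment> \<open>For \<open>u\<close> different from \<open>x\<close>, the chain is
    \<open>M u u v v\<close>, \<open>M u u x x\<close>, \<open>M x x u u\<close>,
    \<open>M x x y y\<close>; otherwise a single \<open>move\<close> suffices.\<close>
  have const: "M u u v v = M x x y y" if "u \<noteq> v" "x \<noteq> y" for u v x y
    using that move[of u v x] sym[of u x] move[of x u y] move[of x v y] by (cases "u = x") auto
  show thesis
  proof (cases "\<exists>x y :: 's. x \<noteq> y")
    case True
    then obtain x y :: 's where xy: "x \<noteq> y" by blast
    \<comment> \<open>Follows by subtraction: the diagonal entries and the entries
      \<open>M u u v v\<close> are already constant, and \<open>diag_sum\<close> ties the three
      kinds together.\<close>
    have exch: "M u v v u = M x y y x" if "u \<noteq> v" for u v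
    proof -
      have "M x x y y + M u v v u = M u u u u"
        by (simp only: diag_sum[OF that] const[OF that xy])
      also have "\<dots> = M x x x x"
        using diag_eq by metis
      also have "\<dots> = M x x y y + M x y y x"
        by (rule diag_sum[OF xy])
      finally show ?thesis by (rule add_left_imp_eq)
    qed
    have "M a b c d = (if a = b \<and> c = d then M x x y y else 0) + (if a = d \<and> b = c then M x y y x else 0)"
      for a b c d
    proof -
      consider "b = a" "c = a" "d = a" | "a = b" "c = d" "a \<noteq> c" | "a = d" "b = c" "a \<noteq> b"
        | "\<not> (a = b \<and> c = d)" "\<not> (a = d \<and> b = c)" by blast
      then show ?thesis
      proof cases
        case 1
        have "M a a a a = M x x x x"
          using diag_eq by metis
        with 1 show ?thesis
          by (simp only: diag_sum[OF xy] simp_thms if_True)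
      next
        case 2
        then show ?thesis by (simp add: const[OF _ xy])
      next
        case 3
        then show ?thesis by (simp add: exch)
      next
        case 4
        then have "M a b c d = 0" by (rule zero)
        then show ?thesis
          by (simp only: if_not_P[OF 4(1)] if_not_P[OF 4(2)] add_0)
      qed
    qed
    then show ?thesis by (rule that)
  next
    case False
    then have eq: "a = b" for a b :: 's by blast
    \<comment> \<open>In dimension one identity and swap coincide, so the whole entry goes into
      \<alpha> and \<beta> is 0. \<open>undefined\<close> merely names the only index.\<close>
    define z :: 's where "z = undefined"
    have "M a b c d = (if a = b \<and> c = d then M z z z z else 0) + (if a = d \<and> b = c then 0 else 0)" for a b c d
      by (simp add: eq[of a z] eq[of b z] eq[of c z] eq[of d z])
    then show ?thesis by (rule that)
  qed
qed

section \<open>Integration over the unitary group\<close>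

lemma continuous_on_adj [continuous_intros]:
  fixes f :: "'b::topological_space \<Rightarrow> complex^'m^'n"
  assumes "continuous_on S f"
  shows "continuous_on S (\<lambda>x. adj (f x))"
  unfolding adj_def map_matrix_def transpose_def using assms
  by (simp add: continuous_intros)

lemma continuous_on_matrix_mult [continuous_intros]:
  fixes f :: "'b::topological_space \<Rightarrow> complex^'m^'n" and g :: "'b \<Rightarrow> complex^'k^'m"
  assumes "continuous_on S f" "continuous_on S g"
  shows "continuous_on S (\<lambda>x. f x ** g x)"
  unfolding matrix_matrix_mult_def using assms by (intro continuous_intros)

lemma continuous_on_trace [continuous_intros]:
  fixes f :: "'b::topological_space \<Rightarrow> complex^'n^'n"
  assumes "continuous_on S f"
  shows "continuous_on S (\<lambda>x. trace (f x))"
  unfolding trace_def using assms by (intro continuous_intros)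

lemma continuous_on_code_projector [continuous_intros]:
  fixes f :: "'b::topological_space \<Rightarrow> complex^'l^'s"
  assumes "continuous_on S f"
  shows "continuous_on S (\<lambda>x. code_projector (f x))"
  unfolding code_projector_def using assms by (intro continuous_intros)

text \<open>Heine-Borel: the defining equations are closed conditions, and the squared Frobenius
  norm of a unitary is the trace of \<open>U ** adj U\<close>, that is, the dimension.\<close>

lemma compact_unitary_group: "compact (unitary_group :: (complex^'s^'s) set)"
proof -
  have "closed {U :: complex^'s^'s. adj U ** U = mat 1}" "closed {U :: complex^'s^'s. U ** adj U = mat 1}"
    by (intro closed_Collect_eq continuous_intros)+
  then have "closed (unitary_group :: (complex^'s^'s) set)"
    unfolding unitary_group_def by (intro closed_Collect_conj)
  moreover have "bounded (unitary_group :: (complex^'s^'s) set)"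
  proof (rule boundedI)
    fix U :: "complex^'s^'s"
    assume "U \<in> unitary_group"
    then have "trace (U ** adj U) = of_nat CARD('s)"
      by (simp add: unitary_group_def trace_I)
    then have "of_real (\<Sum>a\<in>UNIV. \<Sum>b\<in>UNIV. (cmod (U $ a $ b))\<^sup>2) = (of_real (real CARD('s)) :: complex)"
      by (simp add: trace_mult_adj del: of_real_sum of_real_power)
    then have eq: "(\<Sum>a\<in>UNIV. \<Sum>b\<in>UNIV. (cmod (U $ a $ b))\<^sup>2) = real CARD('s)"
      by (simp only: of_real_eq_iff)
    have "norm U = sqrt (real CARD('s))"
      unfolding norm_vec_def L2_set_def eq[symmetric] by (simp add: sum_nonneg)
    then show "norm U \<le> sqrt (real CARD('s))" by simp
  qed
  ultimately show ?thesis
    by (simp add: compact_eq_bounded_closed)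
qed

lemma haar_space:
  assumes "normalized_haar \<mu>"
  shows "space \<mu> = unitary_group"
  using assms sets_eq_imp_space_eq[of \<mu> "restrict_space borel unitary_group"]
  by (simp add: normalized_haar_def space_restrict_space)

lemma haar_borel_measurable:
  assumes "normalized_haar \<mu>" "continuous_on unitary_group f"
  shows "f \<in> borel_measurable \<mu>"
proof -
  have sets: "sets \<mu> = sets (restrict_space borel unitary_group)"
    using assms(1) by (simp add: normalized_haar_def)
  show ?thesis
    using borel_measurable_continuous_on_restrict[OF assms(2)]
    by (simp only: measurable_cong_sets[OF sets refl])
qed

text \<open>A continuous function on a compact group is bounded, and the measure is finite.\<close>

lemma haar_integrable:
  fixes f :: "complex^'s^'s \<Rightarrow> complex"
  assumes haar: "normalized_haar \<mu>" and f: "continuous_on unitary_group f"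
  shows "integrable \<mu> f"
proof -
  interpret prob_space \<mu> using haar by (simp add: normalized_haar_def)
  obtain B where "\<And>U. U \<in> unitary_group \<Longrightarrow> norm (f U) \<le> B"
    using compact_imp_bounded[OF compact_continuous_image[OF f compact_unitary_group]]
    by (auto simp: bounded_iff)
  then show ?thesis
    using haar_borel_measurable[OF haar f] haar_space[OF haar]
    by (intro integrable_const_bound[of _ B] AE_I2) auto
qed

lemma unitary_group_mult:
  assumes "U \<in> unitary_group" "V \<in> unitary_group"
  shows "V ** U \<in> unitary_group"
proof -
  have "adj (V ** U) ** (V ** U) = adj U ** (adj V ** V) ** U"
    "(V ** U) ** adj (V ** U) = V ** (U ** adj U) ** adj V"
    by (simp_all only: adj_mult matrix_mul_assoc)
  then show ?thesis
    using assms by (simp add: unitary_group_def)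
qed

lemma haar_integral_translate:
  fixes f :: "complex^'s^'s \<Rightarrow> complex"
  assumes haar: "normalized_haar \<mu>" and V: "V \<in> unitary_group" and f: "continuous_on unitary_group f"
  shows "(\<integral>U. f (V ** U) \<partial>\<mu>) = (\<integral>U. f U \<partial>\<mu>)"
proof -
  have sets: "sets \<mu> = sets (restrict_space borel unitary_group)"
    and inv: "distr \<mu> \<mu> (\<lambda>U. V ** U) = \<mu>"
    using haar V by (simp_all add: normalized_haar_def)
  \<comment> \<open>The change of variables needs translation as a measurable map of \<mu> into
    itself: it is continuous and stays inside the group.\<close>
  have "(\<lambda>U. V ** U) \<in> borel_measurable \<mu>"
    by (intro haar_borel_measurable[OF haar] continuous_intros)
  then have "(\<lambda>U. V ** U) \<in> measurable \<mu> (restrict_space borel unitary_group)"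
    using V by (intro measurable_restrict_space2) (auto simp: haar_space[OF haar] unitary_group_mult)
  then have "(\<lambda>U. V ** U) \<in> measurable \<mu> \<mu>"
    using measurable_cong_sets[OF refl sets] by blast
  from integral_distr[OF this haar_borel_measurable[OF haar f]] show ?thesis
    by (simp add: inv)
qed

section \<open>Second moments of a random projector\<close>

lemma code_projector_mult_nth:
  "code_projector (V ** W) $ a $ b =
    (\<Sum>a'\<in>UNIV. V $ a $ a' * (\<Sum>b'\<in>UNIV. cnj (V $ b $ b') * code_projector W $ a' $ b'))"
proof -
  have "code_projector (V ** W) = V ** (code_projector W ** adj V)"
    by (simp add: code_projector_def adj_mult matrix_mul_assoc)
  then show ?thesis
    by (simp add: matrix_matrix_mult_def mult.commute)
qed

text \<open>Brings a product of two conjugated entries \<open>V ** P ** adj V\<close> into the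
  nested shape of the hypothesis of \<open>unitary_invariant_tensor\<close>, with the entries of P
  innermost so that the integral can pass through the sums.\<close>

lemma nested_sum_product:
  fixes p q :: "'s::finite \<Rightarrow> 's \<Rightarrow> 'b::comm_semiring_0"
  shows "(\<Sum>a\<in>UNIV. f a * (\<Sum>b\<in>UNIV. g b * p a b)) * (\<Sum>c\<in>UNIV. h c * (\<Sum>d\<in>UNIV. k d * q c d)) =
    (\<Sum>a\<in>UNIV. f a * (\<Sum>b\<in>UNIV. g b * (\<Sum>c\<in>UNIV. h c * (\<Sum>d\<in>UNIV. k d * (p a b * q c d)))))"
proof -
  have left: "x * (\<Sum>c\<in>UNIV. h c * (\<Sum>d\<in>UNIV. k d * q c d)) = (\<Sum>c\<in>UNIV. h c * (\<Sum>d\<in>UNIV. k d * (x * q c d)))" for x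
    unfolding sum_distrib_left by (intro sum.cong refl) (simp add: mult_ac)
  have right: "(\<Sum>a\<in>UNIV. f a * (\<Sum>b\<in>UNIV. g b * p a b)) * x = (\<Sum>a\<in>UNIV. f a * (\<Sum>b\<in>UNIV. g b * (p a b * x)))" for x
    by (simp only: sum_distrib_right mult.assoc)
  show ?thesis
    by (subst right) (simp only: left)
qed

lemma sum_invariant_tensor:
  fixes F :: "'s::finite \<Rightarrow> 's \<Rightarrow> 's \<Rightarrow> 's \<Rightarrow> complex"
  shows "(\<Sum>a\<in>UNIV. \<Sum>b\<in>UNIV. \<Sum>c\<in>UNIV. \<Sum>d\<in>UNIV.
      F a b c d * ((if a = b \<and> c = d then \<alpha> else 0) + (if a = d \<and> b = c then \<beta> else 0))) =
    \<alpha> * (\<Sum>a\<in>UNIV. \<Sum>c\<in>UNIV. F a a c c) + \<beta> * (\<Sum>a\<in>UNIV. \<Sum>b\<in>UNIV. F a b b a)"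
proof -
  \<comment> \<open>The tests are nested with the one on \<open>d\<close> outermost, so that the
    innermost sum, over \<open>d\<close>, collapses first.\<close>
  have "F a b c d * ((if a = b \<and> c = d then \<alpha> else 0) + (if a = d \<and> b = c then \<beta> else 0)) =
    (if d = c then if b = a then \<alpha> * F a b c d else 0 else 0) + (if d = a then if c = b then \<beta> * F a b c d else 0 else 0)"
    for a b c d by (auto simp: algebra_simps)
  then have "(\<Sum>d\<in>UNIV. F a b c d * ((if a = b \<and> c = d then \<alpha> else 0) + (if a = d \<and> b = c then \<beta> else 0))) =
    (if b = a then \<alpha> * F a b c c else 0) + (if c = b then \<beta> * F a b c a else 0)" for a b c
    by (simp add: sum.distrib)
  moreover have "(\<Sum>c\<in>UNIV. if b = a then \<alpha> * F a b c c else 0) = (if b = a then \<Sum>c\<in>UNIV. \<alpha> * F a b c c else 0)" for a b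
    by simp
  ultimately show ?thesis
    by (simp add: sum.distrib sum_distrib_left)
qed

text \<open>Both integrals contract the same invariant tensor, the expectation of P \<otimes> P, so
  one pair of coefficients serves all X and Y. The first trace links the two copies of P crosswise,
  which exchanges the roles of identity and swap.\<close>

lemma haar_projector_moments:
  fixes W :: "complex^'l^'s"
  assumes haar: "normalized_haar \<mu>"
  obtains \<alpha> \<beta> where
    "\<And>X Y. (\<integral>U. trace (code_projector (U ** W) ** X ** code_projector (U ** W) ** Y) \<partial>\<mu>) =
      \<alpha> * trace (X ** Y) + \<beta> * (trace X * trace Y)"
    "\<And>X Y. (\<integral>U. trace (code_projector (U ** W) ** X) * trace (code_projector (U ** W) ** Y) \<partial>\<mu>) =
      \<alpha> * (trace X * trace Y) + \<beta> * trace (X ** Y)"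
proof -
  define P where "P U = code_projector (U ** W)" for U :: "complex^'s^'s"
  define M where "M a b c d = (\<integral>U. P U $ a $ b * P U $ c $ d \<partial>\<mu>)" for a b c d
  have cont: "continuous_on unitary_group (\<lambda>U. P U $ a $ b * P U $ c $ d)" for a b c d
    unfolding P_def by (intro continuous_intros)
  note int = haar_integrable[OF haar cont]
  have inv: "M a b c d = (\<Sum>a'\<in>UNIV. V $ a $ a' * (\<Sum>b'\<in>UNIV. cnj (V $ b $ b') *
      (\<Sum>c'\<in>UNIV. V $ c $ c' * (\<Sum>d'\<in>UNIV. cnj (V $ d $ d') * M a' b' c' d'))))"
    if "V \<in> unitary_group" for V a b c d
  proof -
    have "P (V ** U) $ a $ b * P (V ** U) $ c $ d =
      (\<Sum>a'\<in>UNIV. V $ a $ a' * (\<Sum>b'\<in>UNIV. cnj (V $ b $ b') *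
        (\<Sum>c'\<in>UNIV. V $ c $ c' * (\<Sum>d'\<in>UNIV. cnj (V $ d $ d') * (P U $ a' $ b' * P U $ c' $ d')))))" for U
      unfolding P_def matrix_mul_assoc[symmetric] code_projector_mult_nth[of V]
      by (rule nested_sum_product)
    moreover have "M a b c d = (\<integral>U. P (V ** U) $ a $ b * P (V ** U) $ c $ d \<partial>\<mu>)"
      unfolding M_def by (rule haar_integral_translate[OF haar that cont, symmetric])
    ultimately show ?thesis
      by (simp add: M_def int integrable_sum Bochner_Integration.integral_sum)
  qed
  obtain \<alpha> \<beta> where M: "\<And>a b c d. M a b c d =
      (if a = b \<and> c = d then \<alpha> else 0) + (if a = d \<and> b = c then \<beta> else 0)"
    using unitary_invariant_tensor[of M, OF inv] by blast
  have expand: "(\<integral>U. (\<Sum>a\<in>UNIV. \<Sum>b\<in>UNIV. \<Sum>c\<in>UNIV. \<Sum>d\<in>UNIV. F a b c d * (P U $ a $ b * P U $ c $ d)) \<partial>\<mu>) =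
    \<alpha> * (\<Sum>a\<in>UNIV. \<Sum>c\<in>UNIV. F a a c c) + \<beta> * (\<Sum>a\<in>UNIV. \<Sum>b\<in>UNIV. F a b b a)" for F
    unfolding sum_invariant_tensor[symmetric] M[symmetric] M_def
    by (simp add: int integrable_sum Bochner_Integration.integral_sum)
  have tr: "trace X * trace Y = (\<Sum>a\<in>UNIV. \<Sum>b\<in>UNIV. X $ a $ a * Y $ b $ b)"
    "trace (X ** Y) = (\<Sum>a\<in>UNIV. \<Sum>b\<in>UNIV. X $ a $ b * Y $ b $ a)"
    "trace (X ** Y) = (\<Sum>a\<in>UNIV. \<Sum>b\<in>UNIV. X $ b $ a * Y $ a $ b)" for X Y :: "complex^'s^'s"
  proof -
    show "trace X * trace Y = (\<Sum>a\<in>UNIV. \<Sum>b\<in>UNIV. X $ a $ a * Y $ b $ b)"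
      by (simp add: trace_def sum_product)
    show "trace (X ** Y) = (\<Sum>a\<in>UNIV. \<Sum>b\<in>UNIV. X $ a $ b * Y $ b $ a)"
      by (simp add: trace_def matrix_matrix_mult_def)
    then show "trace (X ** Y) = (\<Sum>a\<in>UNIV. \<Sum>b\<in>UNIV. X $ b $ a * Y $ a $ b)"
      by (subst sum.swap)
  qed
  show thesis
  proof (rule that[of \<alpha> \<beta>])
    fix X Y :: "complex^'s^'s"
    have swapped: "trace X * trace Y = (\<Sum>a\<in>UNIV. \<Sum>b\<in>UNIV. X $ b $ b * Y $ a $ a)"
      by (subst sum.swap) (rule tr)
    have "(\<integral>U. trace (P U ** X ** P U ** Y) \<partial>\<mu>) =
      \<alpha> * (\<Sum>a\<in>UNIV. \<Sum>c\<in>UNIV. X $ a $ c * Y $ c $ a) + \<beta> * (\<Sum>a\<in>UNIV. \<Sum>b\<in>UNIV. X $ b $ b * Y $ a $ a)"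
      unfolding trace_mult_mult_nth by (rule expand)
    then show "(\<integral>U. trace (code_projector (U ** W) ** X ** code_projector (U ** W) ** Y) \<partial>\<mu>) =
      \<alpha> * trace (X ** Y) + \<beta> * (trace X * trace Y)"
      by (simp only: P_def tr(2)[of X Y] swapped)
    have "(\<integral>U. trace (P U ** X) * trace (P U ** Y) \<partial>\<mu>) =
      \<alpha> * (\<Sum>a\<in>UNIV. \<Sum>c\<in>UNIV. X $ a $ a * Y $ c $ c) + \<beta> * (\<Sum>a\<in>UNIV. \<Sum>b\<in>UNIV. X $ b $ a * Y $ a $ b)"
      unfolding trace_times_trace_nth by (rule expand)
    then show "(\<integral>U. trace (code_projector (U ** W) ** X) * trace (code_projector (U ** W) ** Y) \<partial>\<mu>) =
      \<alpha> * (trace X * trace Y) + \<beta> * trace (X ** Y)"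
      by (simp only: P_def tr(1)[of X Y] tr(3)[of X Y])
  qed
qed

text \<open>Taking identity matrices for X and Y in the two moments gives two linear equations for
  \<alpha> and \<beta>, since P has constant trace and is idempotent. With \<open>d\<close> the
  dimension their determinant is \<open>d^2 * (d^2 - 1)\<close>, nonzero for \<open>d\<close> at
  least 2.\<close>

lemma haar_projector_variance:
  fixes W :: "complex^'l^'s" and X Y :: "complex^'s^'s"
  assumes haar: "normalized_haar \<mu>" and W: "adj W ** W = mat 1" and dim: "CARD('s) \<ge> 2"
  shows "(\<integral>U. trace (code_projector (U ** W) ** X ** code_projector (U ** W) ** Y)
        - 1 / of_nat CARD('l) * (trace (code_projector (U ** W) ** X) * trace (code_projector (U ** W) ** Y)) \<partial>\<mu>) =
    ((of_nat CARD('l))\<^sup>2 - 1) / ((of_nat CARD('s))\<^sup>2 - 1) *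
      (trace (X ** Y) - 1 / of_nat CARD('s) * (trace X * trace Y))"
proof -
  let ?P = "\<lambda>U. code_projector (U ** W)"
  obtain \<alpha> \<beta> where
    m1: "\<And>X Y. (\<integral>U. trace (?P U ** X ** ?P U ** Y) \<partial>\<mu>) = \<alpha> * trace (X ** Y) + \<beta> * (trace X * trace Y)"
    and m2: "\<And>X Y. (\<integral>U. trace (?P U ** X) * trace (?P U ** Y) \<partial>\<mu>) = \<alpha> * (trace X * trace Y) + \<beta> * trace (X ** Y)"
    using haar_projector_moments[OF haar, of W] by blast
  interpret prob_space \<mu> using haar by (simp add: normalized_haar_def)
  define k d :: complex where "k = of_nat CARD('l)" and "d = of_nat CARD('s)"
  have isometry: "adj (U ** W) ** (U ** W) = mat 1" if "U \<in> unitary_group" for U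
  proof -
    have "adj (U ** W) ** (U ** W) = adj W ** (adj U ** U) ** W"
      by (simp only: adj_mult matrix_mul_assoc)
    then show ?thesis using that W by (simp add: unitary_group_def)
  qed
  have tr: "trace (?P U) = k" if "U \<in> unitary_group" for U
    unfolding code_projector_def k_def
    by (subst trace_mul_sym) (simp add: isometry[OF that] trace_I)
  have idem: "?P U ** ?P U = ?P U" if "U \<in> unitary_group" for U
  proof -
    have "?P U ** ?P U = (U ** W) ** (adj (U ** W) ** (U ** W)) ** adj (U ** W)"
      by (simp only: code_projector_def matrix_mul_assoc)
    then show ?thesis by (simp only: isometry[OF that] matrix_mul_rid code_projector_def)
  qed
  have "(\<integral>U. trace (?P U) * trace (?P U) \<partial>\<mu>) = (\<integral>U. k\<^sup>2 \<partial>\<mu>)"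
    by (intro Bochner_Integration.integral_cong) (simp_all add: haar_space[OF haar] tr power2_eq_square)
  then have e1: "\<alpha> * d\<^sup>2 + \<beta> * d = k\<^sup>2"
    using m2[of "mat 1" "mat 1"] by (simp add: trace_I d_def power2_eq_square prob_space)
  have "(\<integral>U. trace (?P U ** ?P U) \<partial>\<mu>) = (\<integral>U. k \<partial>\<mu>)"
    by (intro Bochner_Integration.integral_cong) (simp_all add: haar_space[OF haar] tr idem)
  then have e2: "\<alpha> * d + \<beta> * d\<^sup>2 = k"
    using m1[of "mat 1" "mat 1"] by (simp add: trace_I d_def power2_eq_square prob_space)
  have k0: "k \<noteq> 0" and d0: "d \<noteq> 0"
    by (simp_all add: k_def d_def)
  have "1 < (CARD('s))\<^sup>2"
    using mult_le_mono[OF dim dim] by (simp add: power2_eq_square)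
  then have d1: "d\<^sup>2 - 1 \<noteq> 0"
    unfolding d_def by (metis eq_iff_diff_eq_0 less_irrefl of_nat_1 of_nat_eq_iff of_nat_power)
  \<comment> \<open>This is \<open>d\<close> times \<open>e1\<close> minus \<open>e2\<close>; the
    equation for \<beta> below is \<open>d\<close> times \<open>e2\<close> minus
    \<open>e1\<close>.\<close>
  have "\<alpha> * (d\<^sup>2 - 1) * d = k\<^sup>2 * d - k"
    using e1 e2 by algebra
  then have \<alpha>: "\<alpha> = (k\<^sup>2 * d - k) / ((d\<^sup>2 - 1) * d)"
    using d0 d1 by (simp add: field_simps)
  have "\<beta> * (d\<^sup>2 - 1) * d = k * d - k\<^sup>2"
    using e1 e2 by algebra
  then have \<beta>: "\<beta> = (k * d - k\<^sup>2) / ((d\<^sup>2 - 1) * d)"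
    using d0 d1 by (simp add: field_simps)
  \<comment> \<open>The terms \<open>k\<close> cancel in the first numerator and
    \<open>k * d\<close> in the second; both keep the common factor \<open>k^2 - 1\<close>.\<close>
  have coeff1: "\<alpha> - \<beta> / k = (k\<^sup>2 - 1) / (d\<^sup>2 - 1)"
    and coeff2: "\<beta> - \<alpha> / k = - ((k\<^sup>2 - 1) / (d\<^sup>2 - 1) / d)"
    unfolding \<alpha> \<beta> using k0 d0 d1 by (simp_all add: divide_simps) algebra+
  have int1: "integrable \<mu> (\<lambda>U. trace (?P U ** X ** ?P U ** Y))"
    and int2: "integrable \<mu> (\<lambda>U. trace (?P U ** X) * trace (?P U ** Y))"
    by (intro haar_integrable[OF haar] continuous_intros)+
  have "(\<integral>U. trace (?P U ** X ** ?P U ** Y) - 1 / k * (trace (?P U ** X) * trace (?P U ** Y)) \<partial>\<mu>) =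
    (\<integral>U. trace (?P U ** X ** ?P U ** Y) \<partial>\<mu>) - 1 / k * (\<integral>U. trace (?P U ** X) * trace (?P U ** Y) \<partial>\<mu>)"
    by (simp only: Bochner_Integration.integral_diff[OF int1 integrable_mult_right[OF int2]] integral_mult_right_zero)
  also have "\<dots> = (\<alpha> - \<beta> / k) * trace (X ** Y) + (\<beta> - \<alpha> / k) * (trace X * trace Y)"
    unfolding m1 m2 by (simp add: algebra_simps)
  also have "\<dots> = (k\<^sup>2 - 1) / (d\<^sup>2 - 1) * (trace (X ** Y) - 1 / d * (trace X * trace Y))"
  proof -
    have "r * s + - (r / d) * t = r * (s - 1 / d * t)" for r s t
      by (simp add: algebra_simps)
    then show ?thesis
      unfolding coeff1 coeff2 .
  qed
  finally show ?thesis
    unfolding k_def d_def .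
qed

section \<open>The encoder and its averaged infidelity\<close>

lemma append_state_isometry:
  fixes v :: "complex^'a"
  assumes "norm v = 1"
  shows "adj (append_state v) ** append_state v = (mat 1 :: complex^'l^'l)"
proof -
  have "(\<Sum>y\<in>UNIV. cnj (v $ y) * v $ y) = of_real ((norm v)\<^sup>2)"
    by (simp add: norm_vec_def L2_set_def sum_nonneg complex_norm_square mult.commute del: of_real_power)
  then have v: "(\<Sum>y\<in>UNIV. cnj (v $ y) * v $ y) = 1"
    using assms by simp
  have "(adj (append_state v) ** append_state v) $ l $ m = (mat 1 :: complex^'l^'l) $ l $ m" for l m :: 'l
  proof -
    have "(adj (append_state v) ** append_state v) $ l $ m =
      (\<Sum>p\<in>UNIV \<times> UNIV. cnj (mat 1 $ fst p $ l * v $ snd p) * (mat 1 $ fst p $ m * v $ snd p))"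
      by (simp add: matrix_matrix_mult_def append_state_def)
    also have "\<dots> = (\<Sum>x\<in>UNIV. \<Sum>y\<in>UNIV. cnj (mat 1 $ x $ l * v $ y) * (mat 1 $ x $ m * v $ y))"
      by (simp add: sum.cartesian_product case_prod_beta)
    \<comment> \<open>The logical factor is a Kronecker delta and the ancilla factor is the squared
      norm of \<open>v\<close>.\<close>
    also have "\<dots> = (\<Sum>x\<in>UNIV. if x = l then mat 1 $ l $ m * (\<Sum>y\<in>UNIV. cnj (v $ y) * v $ y) else 0)"
      by (intro sum.cong refl) (simp add: mat_def)
    finally show ?thesis by (simp add: v)
  qed
  then show ?thesis by (simp add: vec_eq_iff)
qed

theorem mainTheorem3:
  fixes zero_A :: "complex^'a::finite"
    and A :: "nat \<Rightarrow> complex^('l::finite \<times> 'a)^('l \<times> 'a)"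
    and n :: nat
    and \<mu> :: "(complex^('l \<times> 'a)^('l \<times> 'a)) measure"
  assumes dim: "CARD('l \<times> 'a) \<ge> 2"
    and unit_vector: "norm zero_A = 1"
    and trace_preserving: "(\<Sum>i = 1..n. adj (A i) ** A i) = mat 1"
    and haar: "normalized_haar \<mu>"
  shows "complex_of_real (\<integral>U. (infidelity (encoder U zero_A) n A)\<^sup>2 \<partial>\<mu>) =
    of_nat n * ((of_nat CARD('l))\<^sup>2 - 1) / (4 * of_nat CARD('l) * ((of_nat CARD('l \<times> 'a))\<^sup>2 - 1)) *
    (\<Sum>i = 1..n. \<Sum>j = 1..n.
       trace (adj (A j) ** A i ** adj (A i) ** A j)
       - 1 / of_nat CARD('l \<times> 'a) * of_real ((cmod (trace (adj (A i) ** A j)))\<^sup>2))"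
proof -
  define W :: "complex^'l^('l \<times> 'a)" where "W = append_state zero_A"
  let ?P = "\<lambda>U. code_projector (U ** W)"
  \<comment> \<open>Exchanging \<open>i\<close> and \<open>j\<close> gives the adjoint, so the
    product of the two traces is a squared modulus.\<close>
  let ?X = "\<lambda>i j. adj (A j) ** A i"
  let ?f = "\<lambda>i j U. trace (?P U ** ?X i j ** ?P U ** ?X j i)
    - 1 / of_nat CARD('l) * (trace (?P U ** ?X i j) * trace (?P U ** ?X j i))"
  let ?r = "((of_nat CARD('l))\<^sup>2 - 1) / ((of_nat CARD('l \<times> 'a))\<^sup>2 - 1) :: complex"
  have W: "adj W ** W = mat 1"
    unfolding W_def by (rule append_state_isometry[OF unit_vector])
  have int: "integrable \<mu> (?f i j)" for i j
    by (intro haar_integrable[OF haar] continuous_intros)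
  have int_sum: "(\<integral>U. (\<Sum>i = 1..n. \<Sum>j = 1..n. ?f i j U) \<partial>\<mu>) = (\<Sum>i = 1..n. \<Sum>j = 1..n. \<integral>U. ?f i j U \<partial>\<mu>)"
  proof -
    have "(\<integral>U. (\<Sum>i = 1..n. \<Sum>j = 1..n. ?f i j U) \<partial>\<mu>) = (\<Sum>i = 1..n. \<integral>U. (\<Sum>j = 1..n. ?f i j U) \<partial>\<mu>)"
      by (rule Bochner_Integration.integral_sum) (rule Bochner_Integration.integrable_sum, rule int)
    also have "\<dots> = (\<Sum>i = 1..n. \<Sum>j = 1..n. \<integral>U. ?f i j U \<partial>\<mu>)"
      by (intro sum.cong refl Bochner_Integration.integral_sum) (rule int)
    finally show ?thesis .
  qed
  have "complex_of_real (\<integral>U. (infidelity (encoder U zero_A) n A)\<^sup>2 \<partial>\<mu>) =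
    (\<integral>U. complex_of_real ((infidelity (U ** W) n A)\<^sup>2) \<partial>\<mu>)"
    unfolding encoder_def W_def by (rule integral_complex_of_real[symmetric])
  also have "\<dots> = of_nat n / (4 * of_nat CARD('l)) * (\<Sum>i = 1..n. \<Sum>j = 1..n. \<integral>U. ?f i j U \<partial>\<mu>)"
    unfolding infidelity_squared int_sum[symmetric] by (rule integral_mult_right_zero)
  also have "\<dots> = of_nat n / (4 * of_nat CARD('l)) * (\<Sum>i = 1..n. \<Sum>j = 1..n.
      ?r * (trace (?X i j ** ?X j i) - 1 / of_nat CARD('l \<times> 'a) * (trace (?X i j) * trace (?X j i))))"
    by (simp only: haar_projector_variance[OF haar W dim])
  also have "\<dots> = of_nat n / (4 * of_nat CARD('l)) * ?r * (\<Sum>i = 1..n. \<Sum>j = 1..n.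
       trace (adj (A j) ** A i ** adj (A i) ** A j)
       - 1 / of_nat CARD('l \<times> 'a) * of_real ((cmod (trace (adj (A i) ** A j)))\<^sup>2))"
  proof -
    have "trace (?X i j) * trace (?X j i) = of_real ((cmod (trace (?X j i)))\<^sup>2)" for i j
      using trace_adj[of "?X j i"] by (simp add: adj_mult complex_norm_square mult.commute del: of_real_power)
    then show ?thesis
      by (simp only: sum_distrib_left[symmetric] matrix_mul_assoc mult.assoc)
  qed
  finally show ?thesis by simp
qed

end
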